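(* Let $R$ be an associative ring with unit and let $M$ be a left $R$-module which is $M^{(\Lambda)}$-projective for every index set $\Lambda$ and retractable. If $M$ is a Goldie module, then $S=\operatorname{End}_R(M)$ is a right Goldie ring.
   Context: Modules are unitary left modules; endomorphisms act on the left and multiplication in $S$ is composition, $(fg)(m)=f(g(m))$. $M^{(\Lambda)}$ is the direct sum of copies of $M$ indexed by $\Lambda$. A module $M$ is $L$-projective if for every epimorphism $\rho:L\to L'$ and every homomorphism $\alpha:M\to L'$ there is $\overline{\alpha}:M\to L$ with $\rho\overline{\alpha}=\alpha$. $M$ is retractable if $\operatorname{Hom}_R(M,K)\neq 0$ for every nonzero submodule $K$ of $M$. $M$ is Goldie if the set $\{\bigcap_{f\in X}\operatorname{Ker} f\mid X\subseteq S\}$ satisfies the ascending chain condition and $M$ has finite uniform dimension. A ring $S$ is right Goldie if it satisfies the ascending chain condition on right annihilators of subsets of $S$ and $S_S$ has finite uniform dimension. *)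

theory Defs
  imports "HOL-Algebra.Module" "HOL-Algebra.AbelCoset"
begin

section \<open>Left modules over a ring that need not be commutative\<close>

text \<open>
  HOL-Algebra's locale \<open>module\<close> demands a commutative ring of scalars, so the axioms are restated
  over \<open>ring\<close>.  Its record type and its \<open>submodule\<close>, which do not need commutativity, are
  reused; the inherited record fields \<open>mult\<close> and \<open>one\<close> carry no meaning for a module.
\<close>

locale left_module = R?: ring R + M?: abelian_group M
  for R :: "('r, 'x) ring_scheme" (structure) and M :: "('r, 'm, 'y) module_scheme" (structure) +
  assumes smult_closed:
      "\<lbrakk>a \<in> carrier R; x \<in> carrier M\<rbrakk> \<Longrightarrow> a \<odot>\<^bsub>M\<^esub> x \<in> carrier M"
    and smult_l_distr:
      "\<lbrakk>a \<in> carrier R; b \<in> carrier R; x \<in> carrier M\<rbrakk> \<Longrightarrow>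
        (a \<oplus>\<^bsub>R\<^esub> b) \<odot>\<^bsub>M\<^esub> x = a \<odot>\<^bsub>M\<^esub> x \<oplus>\<^bsub>M\<^esub> b \<odot>\<^bsub>M\<^esub> x"
    and smult_r_distr:
      "\<lbrakk>a \<in> carrier R; x \<in> carrier M; y \<in> carrier M\<rbrakk> \<Longrightarrow>
        a \<odot>\<^bsub>M\<^esub> (x \<oplus>\<^bsub>M\<^esub> y) = a \<odot>\<^bsub>M\<^esub> x \<oplus>\<^bsub>M\<^esub> a \<odot>\<^bsub>M\<^esub> y"
    and smult_assoc1:
      "\<lbrakk>a \<in> carrier R; b \<in> carrier R; x \<in> carrier M\<rbrakk> \<Longrightarrow>
        (a \<otimes>\<^bsub>R\<^esub> b) \<odot>\<^bsub>M\<^esub> x = a \<odot>\<^bsub>M\<^esub> (b \<odot>\<^bsub>M\<^esub> x)"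
    and smult_one:
      "x \<in> carrier M \<Longrightarrow> \<one>\<^bsub>R\<^esub> \<odot>\<^bsub>M\<^esub> x = x"

text \<open>Homomorphisms are extensional on the carrier, so that equality in \<open>Hom\<close> is equality of maps.\<close>

definition mod_hom ::
  "('r, 'x) ring_scheme \<Rightarrow> ('r, 'm, 'y) module_scheme \<Rightarrow> ('r, 'n, 'z) module_scheme \<Rightarrow> ('m \<Rightarrow> 'n) set"
where
  "mod_hom R M N = {f \<in> carrier M \<rightarrow>\<^sub>E carrier N.
     (\<forall>x\<in>carrier M. \<forall>y\<in>carrier M. f (x \<oplus>\<^bsub>M\<^esub> y) = f x \<oplus>\<^bsub>N\<^esub> f y) \<and>
     (\<forall>a\<in>carrier R. \<forall>x\<in>carrier M. f (a \<odot>\<^bsub>M\<^esub> x) = a \<odot>\<^bsub>N\<^esub> f x)}"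

definition End_ring ::
  "('r, 'x) ring_scheme \<Rightarrow> ('r, 'm, 'y) module_scheme \<Rightarrow> ('m \<Rightarrow> 'm) ring"
where
  "End_ring R M =
    \<lparr> carrier = mod_hom R M M,
      monoid.mult = compose (carrier M),
      monoid.one = (\<lambda>x\<in>carrier M. x),
      ring.zero = (\<lambda>x\<in>carrier M. \<zero>\<^bsub>M\<^esub>),
      ring.add = (\<lambda>f g. \<lambda>x\<in>carrier M. f x \<oplus>\<^bsub>M\<^esub> g x) \<rparr>"

definition direct_sum_copies ::
  "'i set \<Rightarrow> ('r, 'm, 'y) module_scheme \<Rightarrow> ('r, 'i \<Rightarrow> 'm) module"
where
  "direct_sum_copies I M =
    \<lparr> carrier = {x \<in> I \<rightarrow>\<^sub>E carrier M. finite {i \<in> I. x i \<noteq> \<zero>\<^bsub>M\<^esub>}},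
      monoid.mult = (\<lambda>_ _. undefined),
      monoid.one = undefined,
      ring.zero = (\<lambda>i\<in>I. \<zero>\<^bsub>M\<^esub>),
      ring.add = (\<lambda>x y. \<lambda>i\<in>I. x i \<oplus>\<^bsub>M\<^esub> y i),
      module.smult = (\<lambda>a x. \<lambda>i\<in>I. a \<odot>\<^bsub>M\<^esub> x i) \<rparr>"


section \<open>Projectivity and retractability\<close>

text \<open>
  A HOL definition cannot quantify over modules on all types.  The codomain \<open>L'\<close> ranges over
  modules on sets of elements of \<open>L\<close>, which is where the quotient modules of \<open>L\<close> live; every
  epimorphic image of \<open>L\<close> is isomorphic to one of these.  That no generality is lost is
  \<open>relatively_projective_any_type\<close> below.
\<close>

definition relatively_projective ::
  "('r, 'x) ring_scheme \<Rightarrow> ('r, 'm, 'y) module_scheme \<Rightarrow> ('r, 'l, 'z) module_scheme \<Rightarrow> bool"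
where
  "relatively_projective R M L \<longleftrightarrow>
    (\<forall>(L' :: ('r, 'l set) module) \<rho> \<alpha>.
       left_module R L' \<and> \<rho> \<in> mod_hom R L L' \<and> \<rho> ` carrier L = carrier L' \<and> \<alpha> \<in> mod_hom R M L' \<longrightarrow>
       (\<exists>\<beta>\<in>mod_hom R M L. \<forall>m\<in>carrier M. \<rho> (\<beta> m) = \<alpha> m))"

text \<open>
  Likewise the index sets are drawn from the type \<open>nat \<times> 'm\<close>.  A map out of \<open>M\<close> only involves,
  for each of its elements, finitely many summands, so larger index sets give nothing new: see
  \<open>projective_all_copies_any_index\<close> below, which gives the property for index sets and codomains
  on arbitrary types.
\<close>

definition projective_all_copies ::
  "('r, 'x) ring_scheme \<Rightarrow> ('r, 'm, 'y) module_scheme \<Rightarrow> bool"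
where
  "projective_all_copies R M \<longleftrightarrow>
    (\<forall>I :: (nat \<times> 'm) set. relatively_projective R M (direct_sum_copies I M))"

definition retractable ::
  "('r, 'x) ring_scheme \<Rightarrow> ('r, 'm, 'y) module_scheme \<Rightarrow> bool"
where
  "retractable R M \<longleftrightarrow>
    (\<forall>K. submodule K R M \<and> K \<noteq> {\<zero>\<^bsub>M\<^esub>} \<longrightarrow>
       (\<exists>f\<in>mod_hom R M (M\<lparr>carrier := K\<rparr>). \<exists>m\<in>carrier M. f m \<noteq> \<zero>\<^bsub>M\<^esub>))"


section \<open>Goldie conditions\<close>

definition ascending_chain_condition :: "'a set set \<Rightarrow> bool"
where
  "ascending_chain_condition \<A> \<longleftrightarrow>
    (\<forall>C :: nat \<Rightarrow> 'a set. (\<forall>n. C n \<in> \<A>) \<and> (\<forall>n. C n \<subseteq> C (Suc n)) \<longrightarrow>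
       (\<exists>n. \<forall>k\<ge>n. C k = C n))"

text \<open>The sum of the submodules \<open>N i\<close>, for \<open>i \<in> I\<close>, is direct.\<close>

definition independent_family ::
  "('r, 'm, 'y) module_scheme \<Rightarrow> ('i \<Rightarrow> 'm set) \<Rightarrow> 'i set \<Rightarrow> bool"
where
  "independent_family M N I \<longleftrightarrow>
    (\<forall>F x. finite F \<and> F \<subseteq> I \<and> (\<forall>i\<in>F. x i \<in> N i) \<and> (\<Oplus>\<^bsub>M\<^esub>i\<in>F. x i) = \<zero>\<^bsub>M\<^esub> \<longrightarrow>
       (\<forall>i\<in>F. x i = \<zero>\<^bsub>M\<^esub>))"

text \<open>
  Finite uniform dimension: there is no infinite direct sum of nonzero submodules.  Sequences
  suffice, because every infinite family contains one.
\<close>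

definition finite_uniform_dimension ::
  "('r, 'x) ring_scheme \<Rightarrow> ('r, 'm, 'y) module_scheme \<Rightarrow> bool"
where
  "finite_uniform_dimension R M \<longleftrightarrow>
    \<not> (\<exists>N :: nat \<Rightarrow> 'm set. (\<forall>i. submodule (N i) R M \<and> N i \<noteq> {\<zero>\<^bsub>M\<^esub>}) \<and>
         independent_family M N UNIV)"

text \<open>The intersection over the empty set of endomorphisms is \<open>M\<close> itself.\<close>

definition kernel_intersection ::
  "('r, 'm, 'y) module_scheme \<Rightarrow> ('m \<Rightarrow> 'm) set \<Rightarrow> 'm set"
where
  "kernel_intersection M X = carrier M \<inter> (\<Inter>f\<in>X. a_kernel M M f)"

definition Goldie_module ::
  "('r, 'x) ring_scheme \<Rightarrow> ('r, 'm, 'y) module_scheme \<Rightarrow> bool"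
where
  "Goldie_module R M \<longleftrightarrow> left_module R M \<and>
    ascending_chain_condition {kernel_intersection M X | X. X \<subseteq> carrier (End_ring R M)} \<and>
    finite_uniform_dimension R M"

definition right_annihilator :: "('s, 'x) ring_scheme \<Rightarrow> 's set \<Rightarrow> 's set"
where
  "right_annihilator S X = {s \<in> carrier S. \<forall>x\<in>X. x \<otimes>\<^bsub>S\<^esub> s = \<zero>\<^bsub>S\<^esub>}"

definition opposite_ring :: "('s, 'x) ring_scheme \<Rightarrow> ('s, 'x) ring_scheme"
where
  "opposite_ring S = S\<lparr>monoid.mult := (\<lambda>x y. y \<otimes>\<^bsub>S\<^esub> x)\<rparr>"

text \<open>
  The right regular module \<open>S\<^sub>S\<close>, regarded as a left module over the opposite ring; its submodules
  are the right ideals of \<open>S\<close>.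
\<close>

definition right_regular_module :: "('s, 'x) ring_scheme \<Rightarrow> ('s, 's) module"
where
  "right_regular_module S =
    \<lparr> carrier = carrier S,
      monoid.mult = monoid.mult S,
      monoid.one = monoid.one S,
      ring.zero = ring.zero S,
      ring.add = ring.add S,
      module.smult = (\<lambda>s x. x \<otimes>\<^bsub>S\<^esub> s) \<rparr>"

definition right_Goldie_ring :: "('s, 'x) ring_scheme \<Rightarrow> bool"
where
  "right_Goldie_ring S \<longleftrightarrow> ring S \<and>
    ascending_chain_condition {right_annihilator S X | X. X \<subseteq> carrier S} \<and>
    finite_uniform_dimension (opposite_ring S) (right_regular_module S)"


section \<open>Independence of the choice of types\<close>

lemma mod_homD:
  assumes "f \<in> mod_hom R M N"
  shows "f \<in> carrier M \<rightarrow>\<^sub>E carrier N"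
    and "\<And>x. x \<in> carrier M \<Longrightarrow> f x \<in> carrier N"
    and "\<And>x y. x \<in> carrier M \<Longrightarrow> y \<in> carrier M \<Longrightarrow> f (x \<oplus>\<^bsub>M\<^esub> y) = f x \<oplus>\<^bsub>N\<^esub> f y"
    and "\<And>a x. a \<in> carrier R \<Longrightarrow> x \<in> carrier M \<Longrightarrow> f (a \<odot>\<^bsub>M\<^esub> x) = a \<odot>\<^bsub>N\<^esub> f x"
  using assms by (auto simp: mod_hom_def)

lemma left_module_via_hom:
  fixes L :: "('r, 'l, 'y) module_scheme" and K :: "('r, 'k, 'z) module_scheme"
  assumes L: "left_module R L"
    and h_on: "h ` carrier L = carrier K"
    and h_add: "\<And>x y. x \<in> carrier L \<Longrightarrow> y \<in> carrier L \<Longrightarrow> h (x \<oplus>\<^bsub>L\<^esub> y) = h x \<oplus>\<^bsub>K\<^esub> h y"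
    and h_smult: "\<And>a x. a \<in> carrier R \<Longrightarrow> x \<in> carrier L \<Longrightarrow> h (a \<odot>\<^bsub>L\<^esub> x) = a \<odot>\<^bsub>K\<^esub> h x"
    and h_zero: "h \<zero>\<^bsub>L\<^esub> = \<zero>\<^bsub>K\<^esub>"
  shows "left_module R K"
proof -
  interpret L: left_module R L by (rule L)
  have rep: "\<exists>x\<in>carrier L. u = h x" if "u \<in> carrier K" for u
    using that h_on by blast
  have cl: "h x \<in> carrier K" if "x \<in> carrier L" for x
    using that h_on by blast
  have "abelian_group K"
  proof (rule abelian_groupI)
    fix u v assume "u \<in> carrier K" "v \<in> carrier K"
    then obtain x y where "x \<in> carrier L" "u = h x" "y \<in> carrier L" "v = h y"
      by (meson rep)
    then show "u \<oplus>\<^bsub>K\<^esub> v \<in> carrier K" "u \<oplus>\<^bsub>K\<^esub> v = v \<oplus>\<^bsub>K\<^esub> u"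
      by (metis L.add.m_closed cl h_add, metis L.add.m_comm h_add)
  next
    show "\<zero>\<^bsub>K\<^esub> \<in> carrier K" by (metis L.zero_closed cl h_zero)
  next
    fix u v w assume "u \<in> carrier K" "v \<in> carrier K" "w \<in> carrier K"
    then obtain x y z where "x \<in> carrier L" "u = h x" "y \<in> carrier L" "v = h y"
      "z \<in> carrier L" "w = h z"
      by (meson rep)
    then show "u \<oplus>\<^bsub>K\<^esub> v \<oplus>\<^bsub>K\<^esub> w = u \<oplus>\<^bsub>K\<^esub> (v \<oplus>\<^bsub>K\<^esub> w)"
      by (simp add: h_add[symmetric] L.add.m_assoc)
  next
    fix u assume "u \<in> carrier K"
    then obtain x where x: "x \<in> carrier L" "u = h x" by (meson rep)
    then show "\<zero>\<^bsub>K\<^esub> \<oplus>\<^bsub>K\<^esub> u = u" by (metis L.l_zero L.zero_closed h_add h_zero)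
    show "\<exists>v\<in>carrier K. v \<oplus>\<^bsub>K\<^esub> u = \<zero>\<^bsub>K\<^esub>"
      by (rule bexI[of _ "h (\<ominus>\<^bsub>L\<^esub> x)"]) (use x in \<open>simp_all add: h_add[symmetric] cl L.l_neg h_zero\<close>)
  qed
  moreover have "left_module_axioms R K"
  proof
    fix a b u v assume a: "a \<in> carrier R" "b \<in> carrier R" "u \<in> carrier K" "v \<in> carrier K"
    then obtain x y where x: "x \<in> carrier L" "u = h x" and y: "y \<in> carrier L" "v = h y"
      by (meson rep)
    note s = a x y h_add[symmetric] h_smult[symmetric] L.smult_closed
    show "a \<odot>\<^bsub>K\<^esub> (u \<oplus>\<^bsub>K\<^esub> v) = a \<odot>\<^bsub>K\<^esub> u \<oplus>\<^bsub>K\<^esub> a \<odot>\<^bsub>K\<^esub> v"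
      by (simp add: s L.smult_r_distr)
  next
    fix a b u assume a: "a \<in> carrier R" "b \<in> carrier R" "u \<in> carrier K"
    then obtain x where x: "x \<in> carrier L" "u = h x"
      by (meson rep)
    note s = a x h_add[symmetric] h_smult[symmetric] L.smult_closed
    show "(a \<oplus>\<^bsub>R\<^esub> b) \<odot>\<^bsub>K\<^esub> u = a \<odot>\<^bsub>K\<^esub> u \<oplus>\<^bsub>K\<^esub> b \<odot>\<^bsub>K\<^esub> u"
      by (simp add: s L.smult_l_distr)
    show "(a \<otimes>\<^bsub>R\<^esub> b) \<odot>\<^bsub>K\<^esub> u = a \<odot>\<^bsub>K\<^esub> (b \<odot>\<^bsub>K\<^esub> u)"
      by (simp add: s L.smult_assoc1)
  next
    fix a u assume a: "a \<in> carrier R" "u \<in> carrier K"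
    then obtain x where x: "x \<in> carrier L" "u = h x"
      by (meson rep)
    show "a \<odot>\<^bsub>K\<^esub> u \<in> carrier K"
      by (simp add: a x h_smult[symmetric] L.smult_closed cl)
  next
    fix u assume "u \<in> carrier K"
    then obtain x where x: "x \<in> carrier L" "u = h x"
      by (meson rep)
    show "\<one>\<^bsub>R\<^esub> \<odot>\<^bsub>K\<^esub> u = u"
      by (simp add: x h_smult[symmetric] L.smult_one)
  qed
  ultimately show ?thesis
    using L.R.ring_axioms L by (simp add: left_module_def)
qed

lemma relatively_projective_any_type:
  fixes M :: "('r, 'm, 'y) module_scheme" and L :: "('r, 'l, 'z) module_scheme"
    and N :: "('r, 'n, 'w) module_scheme"
  assumes proj: "relatively_projective R M L"
    and M: "left_module R M" and L: "left_module R L" and N: "left_module R N"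
    and \<rho>: "\<rho> \<in> mod_hom R L N" and \<alpha>: "\<alpha> \<in> mod_hom R M N"
    and im: "\<alpha> ` carrier M \<subseteq> \<rho> ` carrier L"
  shows "\<exists>\<beta>\<in>mod_hom R M L. \<forall>m\<in>carrier M. \<rho> (\<beta> m) = \<alpha> m"
proof -
  interpret M: left_module R M by (rule M)
  interpret L: left_module R L by (rule L)
  interpret N: left_module R N by (rule N)
  note r = mod_homD[OF \<rho>] and al = mod_homD[OF \<alpha>]
  define h where "h = (\<lambda>y. {x \<in> carrier L. \<rho> x = y})"
  define g where "g = (\<lambda>A. \<rho> (SOME x. x \<in> A))"
  define q where "q = (\<lambda>x\<in>carrier L. h (\<rho> x))"
  have g: "g (h (\<rho> x)) = \<rho> x" if "x \<in> carrier L" for x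
    unfolding g_def h_def using someI[of "\<lambda>z. z \<in> {z \<in> carrier L. \<rho> z = \<rho> x}" x] that by simp
  define L' :: "('r, 'l set) module" where
    "L' = \<lparr> carrier = q ` carrier L, monoid.mult = (\<lambda>_ _. {}), monoid.one = {}, ring.zero = q \<zero>\<^bsub>L\<^esub>,
       ring.add = (\<lambda>A B. h (g A \<oplus>\<^bsub>N\<^esub> g B)), module.smult = (\<lambda>a A. h (a \<odot>\<^bsub>N\<^esub> g A)) \<rparr>"
  have q_add: "q (x \<oplus>\<^bsub>L\<^esub> y) = q x \<oplus>\<^bsub>L'\<^esub> q y" if "x \<in> carrier L" "y \<in> carrier L" for x y
    using that by (simp add: L'_def q_def g r)
  have q_smult: "q (a \<odot>\<^bsub>L\<^esub> x) = a \<odot>\<^bsub>L'\<^esub> q x" if "a \<in> carrier R" "x \<in> carrier L" for a x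
    using that by (simp add: L'_def q_def g r L.smult_closed)
  have q_on: "q ` carrier L = carrier L'" by (simp add: L'_def)
  have mod: "left_module R L'"
    by (rule left_module_via_hom[OF L q_on q_add q_smult]) (simp_all add: L'_def)
  have q: "q \<in> mod_hom R L L'"
    using q_on q_add q_smult by (auto simp: mod_hom_def q_def)
  define \<alpha>' where "\<alpha>' = (\<lambda>m\<in>carrier M. h (\<alpha> m))"
  have rep: "\<exists>x\<in>carrier L. \<alpha> m = \<rho> x" if "m \<in> carrier M" for m
    using that im by blast
  have M_closed: "\<alpha>' m \<in> carrier L'" if m: "m \<in> carrier M" for m
    using rep[OF m] m by (auto simp: \<alpha>'_def L'_def q_def)
  have ga: "g (h (\<alpha> m)) = \<alpha> m" if m: "m \<in> carrier M" for m
    using rep[OF m] g by auto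
  have "\<alpha>' \<in> mod_hom R M L'"
    using M_closed by (auto simp: mod_hom_def \<alpha>'_def L'_def ga al M.smult_closed)
  then obtain \<beta> where b: "\<beta> \<in> mod_hom R M L" "\<forall>m\<in>carrier M. q (\<beta> m) = \<alpha>' m"
    using proj mod q q_on unfolding relatively_projective_def by meson
  have "\<rho> (\<beta> m) = \<alpha> m" if m: "m \<in> carrier M" for m
  proof -
    have bm: "\<beta> m \<in> carrier L" using mod_homD[OF b(1)] m by blast
    have "q (\<beta> m) = \<alpha>' m" using b(2) m by blast
    then have "h (\<rho> (\<beta> m)) = h (\<alpha> m)" using m bm by (simp add: q_def \<alpha>'_def)
    then have "g (h (\<rho> (\<beta> m))) = g (h (\<alpha> m))" by (rule arg_cong)
    then show ?thesis unfolding g[OF bm] ga[OF m] .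
  qed
  then show ?thesis using b by blast
qed

lemma direct_sum_copies_carrier:
  "x \<in> carrier (direct_sum_copies I M) \<longleftrightarrow>
     x \<in> I \<rightarrow>\<^sub>E carrier M \<and> finite {i \<in> I. x i \<noteq> \<zero>\<^bsub>M\<^esub>}"
  by (simp add: direct_sum_copies_def)

lemma (in left_module) smult_zero:
  assumes "a \<in> carrier R" shows "a \<odot>\<^bsub>M\<^esub> \<zero>\<^bsub>M\<^esub> = \<zero>\<^bsub>M\<^esub>"
proof -
  have "a \<odot>\<^bsub>M\<^esub> \<zero>\<^bsub>M\<^esub> \<oplus>\<^bsub>M\<^esub> a \<odot>\<^bsub>M\<^esub> \<zero>\<^bsub>M\<^esub> = a \<odot>\<^bsub>M\<^esub> \<zero>\<^bsub>M\<^esub>"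
    using assms smult_r_distr[of a "\<zero>\<^bsub>M\<^esub>" "\<zero>\<^bsub>M\<^esub>"] by simp
  then show ?thesis
    using assms smult_closed[of a "\<zero>\<^bsub>M\<^esub>"] by (metis M.add.r_cancel_one M.zero_closed)
qed

lemma left_module_direct_sum_copies:
  assumes "left_module R M"
  shows "left_module R (direct_sum_copies I M)"
proof -
  interpret left_module R M by (rule assms)
  let ?D = "direct_sum_copies I M"
  have add: "x \<oplus>\<^bsub>?D\<^esub> y \<in> carrier ?D" if "x \<in> carrier ?D" "y \<in> carrier ?D" for x y
  proof -
    have "{i \<in> I. x i \<oplus>\<^bsub>M\<^esub> y i \<noteq> \<zero>\<^bsub>M\<^esub>} \<subseteq> {i \<in> I. x i \<noteq> \<zero>\<^bsub>M\<^esub>} \<union> {i \<in> I. y i \<noteq> \<zero>\<^bsub>M\<^esub>}" by auto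
    then have "finite {i \<in> I. x i \<oplus>\<^bsub>M\<^esub> y i \<noteq> \<zero>\<^bsub>M\<^esub>}"
      using that by (auto simp: direct_sum_copies_def intro: finite_subset)
    moreover have "{i \<in> I. (x \<oplus>\<^bsub>?D\<^esub> y) i \<noteq> \<zero>\<^bsub>M\<^esub>} = {i \<in> I. x i \<oplus>\<^bsub>M\<^esub> y i \<noteq> \<zero>\<^bsub>M\<^esub>}"
      by (auto simp: direct_sum_copies_def)
    ultimately show ?thesis
      using that by (auto simp: direct_sum_copies_def PiE_iff)
  qed
  have smult: "a \<odot>\<^bsub>?D\<^esub> x \<in> carrier ?D" if "a \<in> carrier R" "x \<in> carrier ?D" for a x
  proof -
    have "{i \<in> I. a \<odot>\<^bsub>M\<^esub> x i \<noteq> \<zero>\<^bsub>M\<^esub>} \<subseteq> {i \<in> I. x i \<noteq> \<zero>\<^bsub>M\<^esub>}"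
      using that smult_zero by auto
    then have "finite {i \<in> I. a \<odot>\<^bsub>M\<^esub> x i \<noteq> \<zero>\<^bsub>M\<^esub>}"
      using that by (auto simp: direct_sum_copies_def intro: finite_subset)
    moreover have "{i \<in> I. (a \<odot>\<^bsub>?D\<^esub> x) i \<noteq> \<zero>\<^bsub>M\<^esub>} = {i \<in> I. a \<odot>\<^bsub>M\<^esub> x i \<noteq> \<zero>\<^bsub>M\<^esub>}"
      by (auto simp: direct_sum_copies_def)
    ultimately show ?thesis
      using that by (auto simp: direct_sum_copies_def PiE_iff smult_closed)
  qed
  have val: "x i \<in> carrier M" if "x \<in> carrier ?D" "i \<in> I" for x i
    using that by (auto simp: direct_sum_copies_def)
  have ext: "x i = undefined" if "x \<in> carrier ?D" "i \<notin> I" for x i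
    using that by (auto simp: direct_sum_copies_def PiE_iff extensional_def)
  have add_at: "(x \<oplus>\<^bsub>?D\<^esub> y) i = (if i \<in> I then x i \<oplus>\<^bsub>M\<^esub> y i else undefined)" for x y i
    by (simp add: direct_sum_copies_def)
  have smult_at: "(a \<odot>\<^bsub>?D\<^esub> x) i = (if i \<in> I then a \<odot>\<^bsub>M\<^esub> x i else undefined)" for a x i
    by (simp add: direct_sum_copies_def)
  have zero_at: "\<zero>\<^bsub>?D\<^esub> i = (if i \<in> I then \<zero>\<^bsub>M\<^esub> else undefined)" for i
    by (simp add: direct_sum_copies_def)
  have neg: "\<exists>y\<in>carrier ?D. y \<oplus>\<^bsub>?D\<^esub> x = \<zero>\<^bsub>?D\<^esub>" if x: "x \<in> carrier ?D" for x
  proof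
    have *: "\<ominus>\<^bsub>R\<^esub> \<one>\<^bsub>R\<^esub> \<in> carrier R" by simp
    have "(\<ominus>\<^bsub>R\<^esub> \<one>\<^bsub>R\<^esub>) \<odot>\<^bsub>M\<^esub> m \<oplus>\<^bsub>M\<^esub> m = \<zero>\<^bsub>M\<^esub>" if m: "m \<in> carrier M" for m
    proof -
      have z: "\<zero>\<^bsub>R\<^esub> \<odot>\<^bsub>M\<^esub> m = \<zero>\<^bsub>M\<^esub>"
        using smult_l_distr[of "\<zero>\<^bsub>R\<^esub>" "\<zero>\<^bsub>R\<^esub>" m] smult_closed[of "\<zero>\<^bsub>R\<^esub>" m] m
        by (metis M.add.r_cancel_one R.l_zero R.zero_closed)
      show ?thesis
        using smult_l_distr[of "\<ominus>\<^bsub>R\<^esub> \<one>\<^bsub>R\<^esub>" "\<one>\<^bsub>R\<^esub>" m] m smult_one[OF m] z by (simp add: R.l_neg)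
    qed
    then show "(\<ominus>\<^bsub>R\<^esub> \<one>\<^bsub>R\<^esub>) \<odot>\<^bsub>?D\<^esub> x \<oplus>\<^bsub>?D\<^esub> x = \<zero>\<^bsub>?D\<^esub>"
      by (auto simp: fun_eq_iff add_at smult_at zero_at val[OF x])
    show "(\<ominus>\<^bsub>R\<^esub> \<one>\<^bsub>R\<^esub>) \<odot>\<^bsub>?D\<^esub> x \<in> carrier ?D" using smult[OF * x] .
  qed
  have "abelian_group ?D"
  proof (rule abelian_groupI)
    show "\<zero>\<^bsub>?D\<^esub> \<in> carrier ?D" by (simp add: direct_sum_copies_def)
    show "\<exists>y\<in>carrier ?D. y \<oplus>\<^bsub>?D\<^esub> x = \<zero>\<^bsub>?D\<^esub>" if "x \<in> carrier ?D" for x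
      by (rule neg[OF that])
  qed (auto simp: add fun_eq_iff add_at zero_at val ext M.a_ac)
  moreover have "left_module_axioms R ?D"
    by unfold_locales
      (auto simp: smult fun_eq_iff add_at smult_at val ext smult_l_distr smult_r_distr
        smult_assoc1 smult_one)
  ultimately show ?thesis
    using R.ring_axioms by (simp add: left_module_def)
qed

lemma projective_all_copies_any_index:
  fixes M :: "('r, 'm, 'y) module_scheme" and N :: "('r, 'n, 'w) module_scheme" and I :: "'i set"
  assumes proj: "projective_all_copies R M"
    and M: "left_module R M" and N: "left_module R N"
    and \<rho>: "\<rho> \<in> mod_hom R (direct_sum_copies I M) N"
    and onto: "\<rho> ` carrier (direct_sum_copies I M) = carrier N"
    and \<alpha>: "\<alpha> \<in> mod_hom R M N"
  shows "\<exists>\<beta>\<in>mod_hom R M (direct_sum_copies I M). \<forall>m\<in>carrier M. \<rho> (\<beta> m) = \<alpha> m"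
proof -
  interpret M: left_module R M by (rule M)
  let ?D = "direct_sum_copies I M"
  note r = mod_homD[OF \<rho>] and al = mod_homD[OF \<alpha>]
  have "\<forall>m\<in>carrier M. \<exists>x. x \<in> carrier ?D \<and> \<rho> x = \<alpha> m"
    using onto al(2) by (metis (no_types, lifting) imageE)
  then obtain b where b: "\<And>m. m \<in> carrier M \<Longrightarrow> b m \<in> carrier ?D \<and> \<rho> (b m) = \<alpha> m"
    by metis
  define s where "s = (\<lambda>m. {i \<in> I. b m i \<noteq> \<zero>\<^bsub>M\<^esub>})"
  define J where "J = (\<Union>m\<in>carrier M. s m)"
  have J: "J \<subseteq> I" by (auto simp: J_def s_def)
  have fin: "finite (s m)" if "m \<in> carrier M" for m
    using b[OF that] by (simp add: direct_sum_copies_carrier s_def)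
  have "\<exists>k :: 'i \<Rightarrow> nat. inj_on k (s m)" if "m \<in> carrier M" for m
    using finite_imp_inj_to_nat_seg[OF fin[OF that]] by blast
  then obtain k :: "'m \<Rightarrow> 'i \<Rightarrow> nat" where k: "\<And>m. m \<in> carrier M \<Longrightarrow> inj_on (k m) (s m)"
    by metis
  have "\<forall>i\<in>J. \<exists>m\<in>carrier M. i \<in> s m" by (auto simp: J_def)
  then obtain c where c: "\<And>i. i \<in> J \<Longrightarrow> c i \<in> carrier M \<and> i \<in> s (c i)"
    by metis
  define e where "e = (\<lambda>i. (k (c i) i, c i))"
  have e: "inj_on e J"
  proof (rule inj_onI)
    fix i j assume ij: "i \<in> J" "j \<in> J" "e i = e j"
    have "c i = c j" using ij(3) unfolding e_def by (rule Pair_inject)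
    moreover from this have "k (c i) i = k (c i) j" using ij(3) unfolding e_def by simp
    ultimately show "i = j"
      using inj_onD[OF k[of "c i"]] c[OF ij(1)] c[OF ij(2)] by metis
  qed
  let ?E = "direct_sum_copies (e ` J) M"
  define u where "u = (\<lambda>x. \<lambda>i\<in>I. if i \<in> J then x (e i) else \<zero>\<^bsub>M\<^esub>)"
  have u_carrier: "u x \<in> carrier ?D" if x: "x \<in> carrier ?E" for x
  proof -
    have u_supp: "{i \<in> I. u x i \<noteq> \<zero>\<^bsub>M\<^esub>} = {i \<in> J. x (e i) \<noteq> \<zero>\<^bsub>M\<^esub>}"
      using J by (auto simp: u_def)
    have "e ` {i \<in> J. x (e i) \<noteq> \<zero>\<^bsub>M\<^esub>} \<subseteq> {p \<in> e ` J. x p \<noteq> \<zero>\<^bsub>M\<^esub>}" by auto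
    moreover have "finite {p \<in> e ` J. x p \<noteq> \<zero>\<^bsub>M\<^esub>}"
      using x by (simp add: direct_sum_copies_carrier)
    ultimately have "finite (e ` {i \<in> J. x (e i) \<noteq> \<zero>\<^bsub>M\<^esub>})" by (rule finite_subset)
    then have "finite {i \<in> J. x (e i) \<noteq> \<zero>\<^bsub>M\<^esub>}"
      by (rule finite_imageD) (rule inj_on_subset[OF e], blast)
    moreover have "x (e i) \<in> carrier M" if "i \<in> J" for i
      using x that PiE_mem[of x "e ` J" "\<lambda>_. carrier M" "e i"]
      by (simp add: direct_sum_copies_carrier)
    then have "u x \<in> I \<rightarrow>\<^sub>E carrier M"
      by (auto simp: u_def)
    ultimately show ?thesis
      by (simp add: direct_sum_copies_carrier u_supp)
  qed
  have u_add: "u (x \<oplus>\<^bsub>?E\<^esub> y) = u x \<oplus>\<^bsub>?D\<^esub> u y" for x y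
    by (auto simp: u_def direct_sum_copies_def fun_eq_iff)
  have u_smult: "u (a \<odot>\<^bsub>?E\<^esub> x) = a \<odot>\<^bsub>?D\<^esub> u x" if "a \<in> carrier R" for a x
    using that by (auto simp: u_def direct_sum_copies_def fun_eq_iff M.smult_zero)
  have E: "left_module R ?E" by (rule left_module_direct_sum_copies[OF M])
  interpret E: left_module R ?E by (rule E)
  define \<sigma> where "\<sigma> = (\<lambda>x\<in>carrier ?E. \<rho> (u x))"
  have \<sigma>: "\<sigma> \<in> mod_hom R ?E N"
    by (auto simp: mod_hom_def \<sigma>_def u_add u_smult u_carrier r E.smult_closed)
  have "\<alpha> ` carrier M \<subseteq> \<sigma> ` carrier ?E"
  proof clarify
    fix m assume m: "m \<in> carrier M"
    define x where "x = (\<lambda>p\<in>e ` J. b m (the_inv_into J e p))"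
    have x_e: "x (e i) = b m i" if "i \<in> J" for i
      using that by (simp add: x_def the_inv_into_f_f[OF e])
    have "{p \<in> e ` J. x p \<noteq> \<zero>\<^bsub>M\<^esub>} \<subseteq> e ` s m" using J x_e by (auto simp: s_def)
    then have "finite {p \<in> e ` J. x p \<noteq> \<zero>\<^bsub>M\<^esub>}"
      by (rule finite_subset) (rule finite_imageI[OF fin[OF m]])
    moreover have "x \<in> e ` J \<rightarrow>\<^sub>E carrier M"
      using b[OF m] J x_e by (fastforce simp: x_def direct_sum_copies_carrier the_inv_into_f_f[OF e])
    ultimately have x: "x \<in> carrier ?E"
      by (simp add: direct_sum_copies_carrier)
    have out: "b m i = \<zero>\<^bsub>M\<^esub>" if "i \<in> I" "i \<notin> J" for i
      using that m by (auto simp: J_def s_def)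
    have "u x = b m"
      using b[OF m] x_e out
      by (auto simp: u_def fun_eq_iff direct_sum_copies_carrier PiE_iff extensional_def)
    then have "\<sigma> x = \<alpha> m" using x b[OF m] by (simp add: \<sigma>_def)
    then show "\<alpha> m \<in> \<sigma> ` carrier ?E" using x by force
  qed
  then obtain \<beta> where \<beta>: "\<beta> \<in> mod_hom R M ?E" "\<forall>m\<in>carrier M. \<sigma> (\<beta> m) = \<alpha> m"
    using relatively_projective_any_type[OF _ M E N \<sigma> \<alpha>] proj
    unfolding projective_all_copies_def by blast
  note be = mod_homD[OF \<beta>(1)]
  let ?\<gamma> = "\<lambda>m\<in>carrier M. u (\<beta> m)"
  have "?\<gamma> \<in> mod_hom R M ?D"
    by (auto simp: mod_hom_def u_carrier be u_add u_smult M.smult_closed)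
  moreover have "\<forall>m\<in>carrier M. \<rho> (?\<gamma> m) = \<alpha> m"
    using \<beta>(2) be(2) by (simp add: \<sigma>_def)
  ultimately show ?thesis by blast
qed

end

theory Submission
  imports Defs
begin

text \<open>
  Right annihilators: the right annihilator of \<open>X\<close> consists of the endomorphisms with image in
  the common kernel of \<open>X\<close>.  Replacing \<open>X\<close> by the left annihilator of its right annihilator makes
  an ascending chain of right annihilators correspond to an ascending chain of kernel intersections.

  Uniform dimension: choose nonzero elements \<open>s i\<close> in the members of an independent sequence of
  right ideals.  If the sum of the submodules \<open>s i M\<close> were not direct, some \<open>s j M\<close> would meet the
  sum of finitely many others in a nonzero submodule, and by retractability there would be a nonzero
  endomorphism \<open>f\<close> with image in this intersection.  Lifting \<open>f\<close> through \<open>s j\<close> and through the map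
  from a finite direct sum given by the other \<open>s i\<close> exhibits \<open>f\<close> as a nonzero element of \<open>s j S\<close> and
  of the sum of the other \<open>s i S\<close>.
\<close>

section \<open>Homomorphisms and submodules\<close>

context left_module
begin

lemma zero_smult: "x \<in> carrier M \<Longrightarrow> \<zero>\<^bsub>R\<^esub> \<odot>\<^bsub>M\<^esub> x = \<zero>\<^bsub>M\<^esub>"
  using smult_l_distr[of "\<zero>\<^bsub>R\<^esub>" "\<zero>\<^bsub>R\<^esub>" x] smult_closed[of "\<zero>\<^bsub>R\<^esub>" x] by simp

lemma minus_eq_smult: "x \<in> carrier M \<Longrightarrow> \<ominus>\<^bsub>M\<^esub> x = (\<ominus>\<^bsub>R\<^esub> \<one>\<^bsub>R\<^esub>) \<odot>\<^bsub>M\<^esub> x"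
  using smult_l_distr[of "\<ominus>\<^bsub>R\<^esub> \<one>\<^bsub>R\<^esub>" "\<one>\<^bsub>R\<^esub>" x]
  by (intro M.minus_equality) (simp_all add: smult_one zero_smult R.l_neg smult_closed)

lemma smult_minus:
  assumes "a \<in> carrier R" "x \<in> carrier M"
  shows "a \<odot>\<^bsub>M\<^esub> (\<ominus>\<^bsub>M\<^esub> x) = \<ominus>\<^bsub>M\<^esub> (a \<odot>\<^bsub>M\<^esub> x)"
proof -
  have "a \<odot>\<^bsub>M\<^esub> (\<ominus>\<^bsub>M\<^esub> x) \<oplus>\<^bsub>M\<^esub> a \<odot>\<^bsub>M\<^esub> x = \<zero>\<^bsub>M\<^esub>"
    using assms smult_r_distr[of a "\<ominus>\<^bsub>M\<^esub> x" x] by (simp add: M.l_neg smult_zero)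
  then show ?thesis
    using assms by (metis M.minus_equality M.a_inv_closed smult_closed)
qed

lemma smult_finsum:
  assumes "a \<in> carrier R" "x \<in> F \<rightarrow> carrier M"
  shows "a \<odot>\<^bsub>M\<^esub> (\<Oplus>\<^bsub>M\<^esub>i\<in>F. x i) = (\<Oplus>\<^bsub>M\<^esub>i\<in>F. a \<odot>\<^bsub>M\<^esub> x i)"
  using assms(2)
proof (induction F rule: infinite_finite_induct)
  case (insert i F)
  then have "x \<in> F \<rightarrow> carrier M" "x i \<in> carrier M" by auto
  moreover from this have "(\<lambda>i. a \<odot>\<^bsub>M\<^esub> x i) \<in> F \<rightarrow> carrier M"
    using assms(1) by (auto intro: smult_closed)
  ultimately show ?case
    using insert assms(1) by (simp add: smult_r_distr smult_closed)
qed (simp_all add: smult_zero assms(1))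

text \<open>Closure under negation comes for free, because -x = (-1) x by
  \<open>minus_eq_smult\<close>.\<close>

lemma left_submoduleI:
  assumes "H \<subseteq> carrier M" "\<zero>\<^bsub>M\<^esub> \<in> H"
    and "\<And>x y. \<lbrakk>x \<in> H; y \<in> H\<rbrakk> \<Longrightarrow> x \<oplus>\<^bsub>M\<^esub> y \<in> H"
    and smult: "\<And>a x. \<lbrakk>a \<in> carrier R; x \<in> H\<rbrakk> \<Longrightarrow> a \<odot>\<^bsub>M\<^esub> x \<in> H"
  shows "submodule H R M"
proof -
  have "\<ominus>\<^bsub>M\<^esub> x \<in> H" if "x \<in> H" for x
    using that assms(1) smult[of "\<ominus>\<^bsub>R\<^esub> \<one>\<^bsub>R\<^esub>" x] by (simp add: minus_eq_smult subset_iff)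
  then show ?thesis
    using assms by (intro submodule.intro subgroup.intro submodule_axioms.intro)
      (simp_all add: a_inv_def)
qed

lemma submodule_minus: "submodule H R M \<Longrightarrow> x \<in> H \<Longrightarrow> \<ominus>\<^bsub>M\<^esub> x \<in> H"
  using subgroup.m_inv_closed[OF submodule.axioms(1)] by (simp add: a_inv_def)

end

text \<open>Stated outside \<open>left_module\<close>, so that it applies to right ideals of S, the
  submodules of \<open>right_regular_module S\<close> over \<open>opposite_ring S\<close>, without
  first showing that this is a left module.\<close>

lemma submoduleD:
  assumes "submodule H R M"
  shows "H \<subseteq> carrier M" "\<zero>\<^bsub>M\<^esub> \<in> H"
    and "\<And>x y. \<lbrakk>x \<in> H; y \<in> H\<rbrakk> \<Longrightarrow> x \<oplus>\<^bsub>M\<^esub> y \<in> H"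
    and "\<And>a x. \<lbrakk>a \<in> carrier R; x \<in> H\<rbrakk> \<Longrightarrow> a \<odot>\<^bsub>M\<^esub> x \<in> H"
  using subgroup.subset[OF submodule.axioms(1)[OF assms]]
    subgroup.one_closed[OF submodule.axioms(1)[OF assms]]
    subgroup.m_closed[OF submodule.axioms(1)[OF assms]]
    submodule.smult_closed[OF assms]
  by simp_all

lemma mod_hom_zero:
  assumes "left_module R M" "left_module R N" "f \<in> mod_hom R M N"
  shows "f \<zero>\<^bsub>M\<^esub> = \<zero>\<^bsub>N\<^esub>"
proof -
  interpret M: left_module R M by fact
  interpret N: left_module R N by fact
  note f = mod_homD[OF assms(3)]
  have "f \<zero>\<^bsub>M\<^esub> \<oplus>\<^bsub>N\<^esub> f \<zero>\<^bsub>M\<^esub> = f \<zero>\<^bsub>M\<^esub>"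
    using f(3)[of "\<zero>\<^bsub>M\<^esub>" "\<zero>\<^bsub>M\<^esub>"] by simp
  then show ?thesis
    using N.M.add.r_cancel_one f(2)[of "\<zero>\<^bsub>M\<^esub>"] by simp
qed

lemma mod_hom_image_submodule:
  assumes "left_module R L" "left_module R M" "f \<in> mod_hom R L M"
  shows "submodule (f ` carrier L) R M"
proof -
  interpret L: left_module R L by fact
  interpret M: left_module R M by fact
  note f = mod_homD[OF assms(3)]
  show ?thesis
  proof (rule M.left_submoduleI)
    show "f ` carrier L \<subseteq> carrier M" using f(2) by blast
    show "\<zero>\<^bsub>M\<^esub> \<in> f ` carrier L"
      using mod_hom_zero[OF assms] L.M.zero_closed by (metis imageI)
    show "x \<oplus>\<^bsub>M\<^esub> y \<in> f ` carrier L" if "x \<in> f ` carrier L" "y \<in> f ` carrier L" for x y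
      using that f(3) L.M.add.m_closed by (metis (no_types, lifting) imageE imageI)
    show "a \<odot>\<^bsub>M\<^esub> x \<in> f ` carrier L" if "a \<in> carrier R" "x \<in> f ` carrier L" for a x
      using that f(4) L.smult_closed by (metis (no_types, lifting) imageE imageI)
  qed
qed

text \<open>Projectivity provides lifts along epimorphisms only. Cutting the codomain down to the
  image of \<rho>, which is a module as a homomorphic image of the direct sum, makes \<rho>
  surjective, and \<alpha> still maps into it by \<open>im\<close>.\<close>

lemma projective_lift:
  fixes M :: "('r, 'm, 'y) module_scheme" and I :: "'i set"
  assumes proj: "projective_all_copies R M" and M: "left_module R M"
    and \<rho>: "\<rho> \<in> mod_hom R (direct_sum_copies I M) M" and \<alpha>: "\<alpha> \<in> mod_hom R M M"
    and im: "\<alpha> ` carrier M \<subseteq> \<rho> ` carrier (direct_sum_copies I M)"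
  shows "\<exists>\<beta>\<in>mod_hom R M (direct_sum_copies I M). \<forall>m\<in>carrier M. \<rho> (\<beta> m) = \<alpha> m"
proof -
  let ?D = "direct_sum_copies I M"
  let ?N = "M\<lparr>carrier := \<rho> ` carrier ?D\<rparr>"
  have D: "left_module R ?D" by (rule left_module_direct_sum_copies[OF M])
  note r = mod_homD[OF \<rho>]
  have N: "left_module R ?N"
    by (rule left_module_via_hom[OF D, of \<rho>]) (simp_all add: r mod_hom_zero[OF D M \<rho>])
  have "\<rho> \<in> mod_hom R ?D ?N" "\<alpha> \<in> mod_hom R M ?N"
    using \<rho> \<alpha> im by (auto simp: mod_hom_def PiE_iff)
  then show ?thesis
    using projective_all_copies_any_index[OF proj M N, of \<rho> I \<alpha>] by simp
qed


section \<open>The endomorphism ring\<close>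

lemma End_ring_simps:
  "carrier (End_ring R M) = mod_hom R M M"
  "f \<otimes>\<^bsub>End_ring R M\<^esub> g = compose (carrier M) f g"
  "\<one>\<^bsub>End_ring R M\<^esub> = (\<lambda>x\<in>carrier M. x)"
  "\<zero>\<^bsub>End_ring R M\<^esub> = (\<lambda>x\<in>carrier M. \<zero>\<^bsub>M\<^esub>)"
  "f \<oplus>\<^bsub>End_ring R M\<^esub> g = (\<lambda>x\<in>carrier M. f x \<oplus>\<^bsub>M\<^esub> g x)"
  by (simp_all add: End_ring_def)

lemma mod_hom_eqI:
  assumes "f \<in> mod_hom R M N" "g \<in> mod_hom R M N" "\<And>x. x \<in> carrier M \<Longrightarrow> f x = g x"
  shows "f = g"
  using assms by (auto simp: mod_hom_def intro: PiE_ext)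

lemma mod_hom_compose:
  assumes "f \<in> mod_hom R M N" "g \<in> mod_hom R L M"
    and "left_module R L"
  shows "compose (carrier L) f g \<in> mod_hom R L N"
proof -
  interpret L: left_module R L by fact
  show ?thesis
    using mod_homD[OF assms(1)] mod_homD[OF assms(2)]
    by (auto simp: mod_hom_def compose_def L.smult_closed)
qed

context left_module
begin

lemma ring_End_ring: "ring (End_ring R M)"
proof -
  let ?S = "End_ring R M"
  have M: "left_module R M" by (rule left_module_axioms)
  have add: "f \<oplus>\<^bsub>?S\<^esub> g \<in> carrier ?S" if "f \<in> carrier ?S" "g \<in> carrier ?S" for f g
  proof -
    note f = mod_homD[OF that(1)[unfolded End_ring_simps]]
    note g = mod_homD[OF that(2)[unfolded End_ring_simps]]
    show ?thesis
      by (auto simp: End_ring_simps mod_hom_def f g smult_closed smult_r_distr M.a_ac)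
  qed
  have mult: "f \<otimes>\<^bsub>?S\<^esub> g \<in> carrier ?S" if "f \<in> carrier ?S" "g \<in> carrier ?S" for f g
    using that mod_hom_compose[OF _ _ M] by (simp add: End_ring_simps)
  have zero: "\<zero>\<^bsub>?S\<^esub> \<in> carrier ?S"
    by (auto simp: End_ring_simps mod_hom_def smult_closed smult_zero)
  have one: "\<one>\<^bsub>?S\<^esub> \<in> carrier ?S"
    by (auto simp: End_ring_simps mod_hom_def smult_closed)
  have val: "f x \<in> carrier M" if "f \<in> carrier ?S" "x \<in> carrier M" for f x
    using mod_homD(2)[OF that(1)[unfolded End_ring_simps]] that(2) .
  have hom_add: "f (x \<oplus>\<^bsub>M\<^esub> y) = f x \<oplus>\<^bsub>M\<^esub> f y"
    if "f \<in> carrier ?S" "x \<in> carrier M" "y \<in> carrier M" for f x y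
    using mod_homD(3)[OF that(1)[unfolded End_ring_simps]] that(2,3) .
  have eq: "f = g" if "f \<in> carrier ?S" "g \<in> carrier ?S" "\<And>x. x \<in> carrier M \<Longrightarrow> f x = g x" for f g
    using mod_hom_eqI that by (simp add: End_ring_simps) blast
  have "abelian_group ?S"
  proof (rule abelian_groupI)
    show "\<exists>g\<in>carrier ?S. g \<oplus>\<^bsub>?S\<^esub> f = \<zero>\<^bsub>?S\<^esub>" if f: "f \<in> carrier ?S" for f
    proof
      note h = mod_homD[OF f[unfolded End_ring_simps]]
      show "(\<lambda>x\<in>carrier M. \<ominus>\<^bsub>M\<^esub> f x) \<in> carrier ?S"
        by (auto simp: End_ring_simps mod_hom_def h smult_closed smult_minus M.minus_add)
      show "(\<lambda>x\<in>carrier M. \<ominus>\<^bsub>M\<^esub> f x) \<oplus>\<^bsub>?S\<^esub> f = \<zero>\<^bsub>?S\<^esub>"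
        using h(2) by (auto simp: End_ring_simps M.l_neg fun_eq_iff)
    qed
    show "\<zero>\<^bsub>?S\<^esub> \<oplus>\<^bsub>?S\<^esub> f = f" if "f \<in> carrier ?S" for f
      by (rule eq[OF add[OF zero that] that]) (simp add: End_ring_simps val[OF that])
  qed (auto simp: add zero, auto simp: End_ring_simps val[unfolded End_ring_simps] M.a_ac)
  moreover have "monoid ?S"
  proof (rule monoidI)
    show "\<one>\<^bsub>?S\<^esub> \<otimes>\<^bsub>?S\<^esub> f = f" if "f \<in> carrier ?S" for f
      by (rule eq[OF mult[OF one that] that]) (simp add: End_ring_simps compose_def val[OF that])
    show "f \<otimes>\<^bsub>?S\<^esub> \<one>\<^bsub>?S\<^esub> = f" if "f \<in> carrier ?S" for f
      by (rule eq[OF mult[OF that one] that]) (simp add: End_ring_simps compose_def)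
    show "f \<otimes>\<^bsub>?S\<^esub> g \<otimes>\<^bsub>?S\<^esub> h = f \<otimes>\<^bsub>?S\<^esub> (g \<otimes>\<^bsub>?S\<^esub> h)"
      if "f \<in> carrier ?S" "g \<in> carrier ?S" "h \<in> carrier ?S" for f g h
      using val[OF that(3)] by (auto simp: End_ring_simps compose_def)
  qed (simp_all add: mult one)
  \<comment> \<open>The distributive laws remain: (f + g) h = f h + g h is the pointwise definition
    of the sum, while h (f + g) = h f + h g uses additivity of h.\<close>
  ultimately show ?thesis
    by (rule ringI) (auto simp: End_ring_simps compose_def fun_eq_iff
        val[unfolded End_ring_simps] hom_add[unfolded End_ring_simps])
qed

text \<open>Evaluation at \<open>x\<close> is additive, so it commutes with finite sums. For
  infinite \<open>F\<close> both sums are zero by convention.\<close>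

lemma finsum_End_apply:
  assumes "h \<in> F \<rightarrow> mod_hom R M M" "x \<in> carrier M"
  shows "(\<Oplus>\<^bsub>End_ring R M\<^esub>i\<in>F. h i) x = (\<Oplus>\<^bsub>M\<^esub>i\<in>F. h i x)"
proof -
  interpret S: ring "End_ring R M" by (rule ring_End_ring)
  show ?thesis
    using assms(1)
  proof (induction F rule: infinite_finite_induct)
    case (insert i F)
    then have "h \<in> F \<rightarrow> carrier (End_ring R M)" "h i \<in> carrier (End_ring R M)"
      by (auto simp: End_ring_simps)
    moreover from this have "(\<lambda>i. h i x) \<in> F \<rightarrow> carrier M" "h i x \<in> carrier M"
      using assms(2) by (auto simp: End_ring_simps Pi_iff dest: mod_homD(2))
    ultimately show ?case
      using insert assms(2) by (simp add: End_ring_simps(5))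
  qed (simp_all add: End_ring_simps assms(2))
qed

section \<open>Sums of images of endomorphisms and lifting through them\<close>

text \<open>This is the map M^(F) -> M induced by the family \<open>s\<close> through the universal
  property of the direct sum. The intended case is finite \<open>F\<close>; for infinite
  \<open>F\<close> the sum is zero by convention and the map is the zero map.\<close>

lemma finsum_copies_hom:
  assumes s: "s \<in> F \<rightarrow> mod_hom R M M"
  shows "(\<lambda>x\<in>carrier (direct_sum_copies F M). \<Oplus>\<^bsub>M\<^esub>i\<in>F. s i (x i))
    \<in> mod_hom R (direct_sum_copies F M) M"
proof -
  let ?D = "direct_sum_copies F M"
  interpret D: left_module R ?D
    by (rule left_module_direct_sum_copies) (rule left_module_axioms)
  have s': "s i \<in> mod_hom R M M" if "i \<in> F" for i using s that by blast
  note h = mod_homD[OF s']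
  have val: "x i \<in> carrier M" if "x \<in> carrier ?D" "i \<in> F" for x i
    using that by (auto simp: direct_sum_copies_carrier)
  have sval: "(\<lambda>i. s i (x i)) \<in> F \<rightarrow> carrier M" if "x \<in> carrier ?D" for x
    using val[OF that] h(2) by blast
  have "(\<Oplus>\<^bsub>M\<^esub>i\<in>F. s i ((x \<oplus>\<^bsub>?D\<^esub> y) i)) = (\<Oplus>\<^bsub>M\<^esub>i\<in>F. s i (x i)) \<oplus>\<^bsub>M\<^esub> (\<Oplus>\<^bsub>M\<^esub>i\<in>F. s i (y i))"
    if "x \<in> carrier ?D" "y \<in> carrier ?D" for x y
  proof -
    have "(\<Oplus>\<^bsub>M\<^esub>i\<in>F. s i ((x \<oplus>\<^bsub>?D\<^esub> y) i)) = (\<Oplus>\<^bsub>M\<^esub>i\<in>F. s i (x i) \<oplus>\<^bsub>M\<^esub> s i (y i))"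
    proof (rule M.finsum_cong')
      show "(\<lambda>i. s i (x i) \<oplus>\<^bsub>M\<^esub> s i (y i)) \<in> F \<rightarrow> carrier M"
        using sval that by (simp add: Pi_iff)
      show "s i ((x \<oplus>\<^bsub>?D\<^esub> y) i) = s i (x i) \<oplus>\<^bsub>M\<^esub> s i (y i)" if i: "i \<in> F" for i
        using h(3)[OF i] val \<open>x \<in> carrier ?D\<close> \<open>y \<in> carrier ?D\<close> i
        by (simp add: direct_sum_copies_def)
    qed simp
    then show ?thesis using M.finsum_addf[OF sval sval] that by simp
  qed
  moreover have "(\<Oplus>\<^bsub>M\<^esub>i\<in>F. s i ((a \<odot>\<^bsub>?D\<^esub> x) i)) = a \<odot>\<^bsub>M\<^esub> (\<Oplus>\<^bsub>M\<^esub>i\<in>F. s i (x i))"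
    if "a \<in> carrier R" "x \<in> carrier ?D" for a x
  proof -
    have "(\<Oplus>\<^bsub>M\<^esub>i\<in>F. s i ((a \<odot>\<^bsub>?D\<^esub> x) i)) = (\<Oplus>\<^bsub>M\<^esub>i\<in>F. a \<odot>\<^bsub>M\<^esub> s i (x i))"
    proof (rule M.finsum_cong')
      show "(\<lambda>i. a \<odot>\<^bsub>M\<^esub> s i (x i)) \<in> F \<rightarrow> carrier M"
        using sval that by (simp add: Pi_iff smult_closed)
      show "s i ((a \<odot>\<^bsub>?D\<^esub> x) i) = a \<odot>\<^bsub>M\<^esub> s i (x i)" if i: "i \<in> F" for i
        using h(4)[OF i \<open>a \<in> carrier R\<close> val[OF \<open>x \<in> carrier ?D\<close> i]] i
        by (simp add: direct_sum_copies_def)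
    qed simp
    then show ?thesis using smult_finsum[OF that(1) sval] that by simp
  qed
  ultimately show ?thesis
    using sval by (simp add: mod_hom_def D.smult_closed)
qed

text \<open>For finite \<open>F\<close> this is the submodule sum of the \<open>s i\<close> M. It
  ranges over extensional families of arguments, rather than over values, so that for finite
  \<open>F\<close> these families are exactly the elements of M^(F).\<close>

definition image_sum :: "('i \<Rightarrow> 'm \<Rightarrow> 'm) \<Rightarrow> 'i set \<Rightarrow> 'm set" where
  "image_sum s F = {\<Oplus>\<^bsub>M\<^esub>i\<in>F. s i (x i) | x. x \<in> F \<rightarrow>\<^sub>E carrier M}"

lemma image_sumI:
  assumes "s \<in> F \<rightarrow> mod_hom R M M" "\<And>i. i \<in> F \<Longrightarrow> y i \<in> s i ` carrier M"
  shows "(\<Oplus>\<^bsub>M\<^esub>i\<in>F. y i) \<in> image_sum s F"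
proof -
  have "\<forall>i\<in>F. \<exists>x. x \<in> carrier M \<and> y i = s i x" using assms(2) by blast
  then obtain x where x: "\<And>i. i \<in> F \<Longrightarrow> x i \<in> carrier M \<and> y i = s i (x i)" by metis
  have "(\<Oplus>\<^bsub>M\<^esub>i\<in>F. y i) = (\<Oplus>\<^bsub>M\<^esub>i\<in>F. s i (restrict x F i))"
    using x mod_homD(2)[OF funcset_mem[OF assms(1)]] by (intro M.finsum_cong') auto
  \<comment> \<open>The chosen preimages are cut off outside \<open>F\<close>, which leaves the sum
    unchanged and makes the family extensional.\<close>
  moreover have "restrict x F \<in> F \<rightarrow>\<^sub>E carrier M" using x by auto
  ultimately show ?thesis unfolding image_sum_def by blast
qed

text \<open>For finite \<open>F\<close> the finite support condition on the direct sum is vacuous.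
  The sum of images thus becomes the image of the induced map, the form needed for lifting.\<close>

lemma image_sum_eq_image:
  assumes "finite F"
  shows "image_sum s F = (\<lambda>x\<in>carrier (direct_sum_copies F M). \<Oplus>\<^bsub>M\<^esub>i\<in>F. s i (x i))
    ` carrier (direct_sum_copies F M)"
proof -
  have "carrier (direct_sum_copies F M) = F \<rightarrow>\<^sub>E carrier M"
    using assms by (auto simp: direct_sum_copies_carrier)
  then show ?thesis
    by (simp add: image_sum_def Setcompr_eq_image)
qed

lemma image_sum_submodule:
  assumes "finite F" "s \<in> F \<rightarrow> mod_hom R M M"
  shows "submodule (image_sum s F) R M"
  unfolding image_sum_eq_image[OF assms(1)]
  by (intro mod_hom_image_submodule left_module_direct_sum_copies finsum_copies_hom
      left_module_axioms assms)

text \<open>Projectivity turns an inclusion of images into membership in the right ideal generated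
  by the \<open>s i\<close>: a lift of \<open>f\<close> along M^(F) -> M has coordinates in S, and
  these are the coefficients.\<close>

lemma lift_through_image_sum:
  assumes proj: "projective_all_copies R M"
    and F: "finite F" and s: "s \<in> F \<rightarrow> mod_hom R M M"
    and f: "f \<in> mod_hom R M M" "f ` carrier M \<subseteq> image_sum s F"
  obtains g where "g \<in> F \<rightarrow> carrier (End_ring R M)"
    and "f = (\<Oplus>\<^bsub>End_ring R M\<^esub>i\<in>F. s i \<otimes>\<^bsub>End_ring R M\<^esub> g i)"
proof -
  let ?D = "direct_sum_copies F M" and ?S = "End_ring R M"
  interpret S: ring ?S by (rule ring_End_ring)
  obtain \<beta> where \<beta>: "\<beta> \<in> mod_hom R M ?D"
    and \<beta>_lift: "\<forall>m\<in>carrier M. (\<lambda>x\<in>carrier ?D. \<Oplus>\<^bsub>M\<^esub>i\<in>F. s i (x i)) (\<beta> m) = f m"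
    by (rule bexE[OF projective_lift[OF proj left_module_axioms finsum_copies_hom[OF s] f(1)
          f(2)[unfolded image_sum_eq_image[OF F]]]])
  note b = mod_homD[OF \<beta>]
  have lift: "(\<Oplus>\<^bsub>M\<^esub>i\<in>F. s i (\<beta> m i)) = f m" if "m \<in> carrier M" for m
    using bspec[OF \<beta>_lift that] b(2)[OF that] by simp
  \<comment> \<open>The coordinates of the lift \<beta>.\<close>
  define g where "g i = (\<lambda>m\<in>carrier M. \<beta> m i)" for i
  have val: "\<beta> m i \<in> carrier M" if "m \<in> carrier M" "i \<in> F" for m i
    using b(2)[OF that(1)] that(2) by (auto simp: direct_sum_copies_carrier)
  have g: "g \<in> F \<rightarrow> carrier ?S"
    by (auto simp: End_ring_simps mod_hom_def g_def val b smult_closed)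
      (simp_all add: direct_sum_copies_def)
  have sg: "(\<lambda>i. s i \<otimes>\<^bsub>?S\<^esub> g i) \<in> F \<rightarrow> carrier ?S"
    using g s by (auto simp: Pi_iff End_ring_simps(1)[symmetric] intro: S.m_closed)
  have "f = (\<Oplus>\<^bsub>?S\<^esub>i\<in>F. s i \<otimes>\<^bsub>?S\<^esub> g i)"
  proof (rule mod_hom_eqI[OF f(1)])
    show "(\<Oplus>\<^bsub>?S\<^esub>i\<in>F. s i \<otimes>\<^bsub>?S\<^esub> g i) \<in> mod_hom R M M"
      using S.finsum_closed[OF sg] by (simp add: End_ring_simps(1))
    fix m assume m: "m \<in> carrier M"
    have "(\<Oplus>\<^bsub>?S\<^esub>i\<in>F. s i \<otimes>\<^bsub>?S\<^esub> g i) m = (\<Oplus>\<^bsub>M\<^esub>i\<in>F. (s i \<otimes>\<^bsub>?S\<^esub> g i) m)"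
      using finsum_End_apply[OF _ m] sg by (simp add: End_ring_simps(1))
    also have "\<dots> = (\<Oplus>\<^bsub>M\<^esub>i\<in>F. s i (\<beta> m i))"
      using m by (simp add: End_ring_simps(2) compose_def g_def)
    finally show "f m = (\<Oplus>\<^bsub>?S\<^esub>i\<in>F. s i \<otimes>\<^bsub>?S\<^esub> g i) m"
      using lift[OF m] by simp
  qed
  with g show thesis by (rule that)
qed


section \<open>The Goldie conditions\<close>

text \<open>A product x s vanishes exactly when the image of s lies in the kernel of x. Hence the
  annihilator depends on \<open>X\<close> only through its kernel intersection.\<close>

lemma right_annihilator_End_ring:
  assumes "X \<subseteq> mod_hom R M M"
  shows "right_annihilator (End_ring R M) X =
    {s \<in> mod_hom R M M. s ` carrier M \<subseteq> kernel_intersection M X}"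
proof -
  have zero_iff: "x \<otimes>\<^bsub>End_ring R M\<^esub> s = \<zero>\<^bsub>End_ring R M\<^esub> \<longleftrightarrow>
      (\<forall>m\<in>carrier M. x (s m) = \<zero>\<^bsub>M\<^esub>)" for x s
    unfolding End_ring_simps compose_def
  proof
    assume "(\<lambda>m\<in>carrier M. x (s m)) = (\<lambda>m\<in>carrier M. \<zero>\<^bsub>M\<^esub>)"
    then have "restrict (\<lambda>m. x (s m)) (carrier M) m = restrict (\<lambda>m. \<zero>\<^bsub>M\<^esub>) (carrier M) m" for m
      by simp
    then show "\<forall>m\<in>carrier M. x (s m) = \<zero>\<^bsub>M\<^esub>"
      by (metis (no_types, lifting) restrict_apply')
  qed (rule restrict_ext, blast)
  have "s \<in> right_annihilator (End_ring R M) X \<longleftrightarrow>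
      s \<in> {s \<in> mod_hom R M M. s ` carrier M \<subseteq> kernel_intersection M X}" for s
  proof (cases "s \<in> mod_hom R M M")
    case True
    note val = mod_homD(2)[OF True]
    have "s \<in> right_annihilator (End_ring R M) X \<longleftrightarrow>
        (\<forall>x\<in>X. \<forall>m\<in>carrier M. x (s m) = \<zero>\<^bsub>M\<^esub>)"
      unfolding right_annihilator_def zero_iff using True by (simp add: End_ring_simps(1))
    also have "\<dots> \<longleftrightarrow> s ` carrier M \<subseteq> kernel_intersection M X"
      unfolding kernel_intersection_def a_kernel_def' using val by blast
    finally show ?thesis using True by simp
  qed (simp add: right_annihilator_def End_ring_simps(1))
  then show ?thesis by blast
qed

lemma acc_right_annihilators_End_ring:
  assumes acc: "ascending_chain_condition
    {kernel_intersection M X | X. X \<subseteq> carrier (End_ring R M)}"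
  shows "ascending_chain_condition
    {right_annihilator (End_ring R M) X | X. X \<subseteq> carrier (End_ring R M)}"
  unfolding ascending_chain_condition_def
proof (intro allI impI, elim conjE)
  let ?S = "End_ring R M"
  fix C assume C: "\<forall>n::nat. C n \<in> {right_annihilator ?S X | X. X \<subseteq> carrier ?S}"
    and mono: "\<forall>n. C n \<subseteq> C (Suc n)"
  \<comment> \<open>The sets whose right annihilators are the \<open>C n\<close> need not be nested.
    The left annihilators of the \<open>C n\<close> are, since they reverse inclusions.\<close>
  define l where "l n = {x \<in> carrier ?S. \<forall>s\<in>C n. x \<otimes>\<^bsub>?S\<^esub> s = \<zero>\<^bsub>?S\<^esub>}" for n
  have l: "l n \<subseteq> carrier ?S" for n by (auto simp: l_def)
  \<comment> \<open>The usual triple annihilator law: \<open>l n\<close> contains \<open>X\<close>,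
    and it annihilates \<open>C n\<close> by construction.\<close>
  have C_eq: "C n = right_annihilator ?S (l n)" for n
  proof -
    obtain X where "X \<subseteq> carrier ?S" "C n = right_annihilator ?S X" using C by blast
    then show ?thesis by (auto simp: l_def right_annihilator_def)
  qed
  define K where "K n = kernel_intersection M (l n)" for n
  have "l (Suc n) \<subseteq> l n" for n
    using mono unfolding l_def by blast
  then have "K n \<subseteq> K (Suc n)" for n
    unfolding K_def kernel_intersection_def by blast
  moreover have "K n \<in> {kernel_intersection M X | X. X \<subseteq> carrier ?S}" for n
    using l by (auto simp: K_def)
  ultimately obtain n where n: "\<forall>k\<ge>n. K k = K n"
    using acc unfolding ascending_chain_condition_def by blast
  \<comment> \<open>\<open>C k\<close> is recovered from \<open>K k\<close> alone, so the two chains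
    become constant together.\<close>
  have "C k = {s \<in> mod_hom R M M. s ` carrier M \<subseteq> K k}" for k
    using C_eq[of k] right_annihilator_End_ring l[of k] by (simp add: K_def End_ring_simps(1))
  with n show "\<exists>n. \<forall>k\<ge>n. C k = C n" by metis
qed

section \<open>Independent families and uniform dimension\<close>

text \<open>With this, the lifting lemma also covers a single endomorphism: if f M is contained in
  \<open>s i\<close> M, then f lies in \<open>s i\<close> S.\<close>

lemma image_sum_singleton:
  assumes "s i \<in> mod_hom R M M"
  shows "image_sum s {i} = s i ` carrier M"
proof -
  have *: "(\<Oplus>\<^bsub>M\<^esub>j\<in>{i}. s j (x j)) = s i (x i)" if "x i \<in> carrier M" for x
    using mod_homD(2)[OF assms that] by simp
  show ?thesis
  proof
    show "image_sum s {i} \<subseteq> s i ` carrier M"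
    proof
      fix y assume "y \<in> image_sum s {i}"
      then obtain x where "x \<in> {i} \<rightarrow>\<^sub>E carrier M" "y = (\<Oplus>\<^bsub>M\<^esub>j\<in>{i}. s j (x j))"
        unfolding image_sum_def by blast
      moreover from this have "x i \<in> carrier M" by blast
      ultimately show "y \<in> s i ` carrier M" using *[of x] by blast
    qed
    show "s i ` carrier M \<subseteq> image_sum s {i}"
    proof
      fix y assume y: "y \<in> s i ` carrier M"
      then have "y \<in> carrier M" using mod_homD(2)[OF assms] by blast
      then show "y \<in> image_sum s {i}"
        using image_sumI[of s "{i}" "\<lambda>_. y"] assms y by simp
    qed
  qed
qed

lemma independent_images:
  assumes proj: "projective_all_copies R M" and retr: "retractable R M"
    and J: "\<And>i. submodule (J i) (opposite_ring (End_ring R M)) (right_regular_module (End_ring R M))"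
    and ind: "independent_family (right_regular_module (End_ring R M)) J I"
    and sJ: "\<And>i. i \<in> I \<Longrightarrow> s i \<in> J i"
  shows "independent_family M (\<lambda>i. s i ` carrier M) I"
  unfolding independent_family_def
proof (intro allI impI ballI, elim conjE)
  let ?S = "End_ring R M"
  interpret S: ring ?S by (rule ring_End_ring)
  fix F x j
  assume F: "finite F" "F \<subseteq> I" and x: "\<forall>i\<in>F. x i \<in> s i ` carrier M"
    and sum: "(\<Oplus>\<^bsub>M\<^esub>i\<in>F. x i) = \<zero>\<^bsub>M\<^esub>" and j: "j \<in> F"
  \<comment> \<open>Translation into S: scalars of the opposite ring act by right multiplication,
    and \<open>finsum\<close> depends only on the carrier, addition and zero, which are those of
    S.\<close>
  have reg: "carrier (right_regular_module ?S) = carrier ?S"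
    "\<zero>\<^bsub>right_regular_module ?S\<^esub> = \<zero>\<^bsub>?S\<^esub>"
    "finsum (right_regular_module ?S) = finsum ?S"
    "a \<odot>\<^bsub>right_regular_module ?S\<^esub> b = b \<otimes>\<^bsub>?S\<^esub> a"
    "carrier (opposite_ring ?S) = carrier ?S" for a b
    by (simp_all add: right_regular_module_def opposite_ring_def finsum_def finprod_def fun_eq_iff)
  have J_mult: "t \<otimes>\<^bsub>?S\<^esub> g \<in> J i" if "t \<in> J i" "g \<in> carrier ?S" for t g i
    using submoduleD(4)[OF J] that by (simp add: reg)
  have J_sub: "J i \<subseteq> carrier ?S" for i
    using submoduleD(1)[OF J] by (simp add: reg)
  have sC: "s i \<in> carrier ?S" if "i \<in> F" for i
    using sJ J_sub F(2) that by blast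
  then have s: "s \<in> F \<rightarrow> mod_hom R M M" by (simp add: End_ring_simps(1))
  have s1: "s \<in> {j} \<rightarrow> mod_hom R M M" and s2: "s \<in> F - {j} \<rightarrow> mod_hom R M M"
    using s j by auto
  have F': "finite (F - {j})" using F by simp
  have xM: "x i \<in> carrier M" if "i \<in> F" for i
  proof -
    from bspec[OF x that] obtain z where "x i = s i z" "z \<in> carrier M" by (rule imageE)
    then show ?thesis using mod_homD(2)[OF funcset_mem[OF s that]] by simp
  qed
  \<comment> \<open>The intersection that would be zero if the sum were direct at
    \<open>j\<close>.\<close>
  let ?K = "s j ` carrier M \<inter> image_sum s (F - {j})"
  note subm = image_sum_submodule[OF F' s2]
    image_sum_submodule[OF finite.insertI[OF finite.emptyI] s1]
  note single = image_sum_singleton[of s j]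
  have sj: "submodule (s j ` carrier M) R M"
    using subm(2) single s1 by simp
  have K: "submodule ?K R M"
  proof (rule left_submoduleI)
    show "?K \<subseteq> carrier M" using submoduleD(1)[OF sj] by blast
  qed (simp_all add: submoduleD[OF sj] submoduleD[OF subm(1)])
  show "x j = \<zero>\<^bsub>M\<^esub>"
  proof (rule ccontr)
    assume nz: "x j \<noteq> \<zero>\<^bsub>M\<^esub>"
    have "(\<Oplus>\<^bsub>M\<^esub>i\<in>insert j (F - {j}). x i) = x j \<oplus>\<^bsub>M\<^esub> (\<Oplus>\<^bsub>M\<^esub>i\<in>F - {j}. x i)"
      using F' xM j by (intro M.finsum_insert) simp_all
    then have "x j \<oplus>\<^bsub>M\<^esub> (\<Oplus>\<^bsub>M\<^esub>i\<in>F - {j}. x i) = \<zero>\<^bsub>M\<^esub>"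
      using sum j by (simp add: insert_absorb)
    moreover have "(\<Oplus>\<^bsub>M\<^esub>i\<in>F - {j}. x i) \<in> carrier M"
      using xM by (intro M.finsum_closed) auto
    \<comment> \<open>Splitting off \<open>x j\<close> from the zero sum shows that it is minus an
      element of the sum of the other images. This puts the nonzero \<open>x j\<close> into
      \<open>?K\<close>.\<close>
    ultimately have "x j = \<ominus>\<^bsub>M\<^esub> (\<Oplus>\<^bsub>M\<^esub>i\<in>F - {j}. x i)"
      using xM[OF j] by (metis M.minus_equality)
    moreover have "(\<Oplus>\<^bsub>M\<^esub>i\<in>F - {j}. x i) \<in> image_sum s (F - {j})"
      using x by (intro image_sumI[OF s2]) auto
    ultimately have "x j \<in> image_sum s (F - {j})"
      using submodule_minus[OF subm(1)] by simp
    then have "x j \<in> ?K"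
      using bspec[OF x j] by (rule IntI[rotated])
    then have "?K \<noteq> {\<zero>\<^bsub>M\<^esub>}" using nz by blast
    \<comment> \<open>Retractability replaces the nonzero element of \<open>?K\<close> by a nonzero
      endomorphism with image in \<open>?K\<close>, for which lifting is available.\<close>
    then obtain f m where f: "f \<in> mod_hom R M (M\<lparr>carrier := ?K\<rparr>)"
      and m: "m \<in> carrier M" "f m \<noteq> \<zero>\<^bsub>M\<^esub>"
      using retr K unfolding retractable_def by blast
    have fK: "f ` carrier M \<subseteq> ?K" using mod_homD(2)[OF f] by auto
    have fM: "f \<in> mod_hom R M M"
      using f submoduleD(1)[OF K] by (auto simp: mod_hom_def PiE_iff)
    \<comment> \<open>The same \<open>f\<close> is lifted twice: here through the \<open>s i\<close>
      with \<open>i\<close> different from \<open>j\<close>, then through \<open>s j\<close>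
      alone.\<close>
    obtain g where g: "g \<in> F - {j} \<rightarrow> carrier ?S"
      and fg: "f = (\<Oplus>\<^bsub>?S\<^esub>i\<in>F - {j}. s i \<otimes>\<^bsub>?S\<^esub> g i)"
      using lift_through_image_sum[OF proj F' s2 fM] fK by blast
    obtain h where h: "h \<in> {j} \<rightarrow> carrier ?S"
      and fh: "f = (\<Oplus>\<^bsub>?S\<^esub>i\<in>{j}. s i \<otimes>\<^bsub>?S\<^esub> h i)"
      using lift_through_image_sum[OF proj _ s1 fM] fK single s1 by auto
    have fh': "f = s j \<otimes>\<^bsub>?S\<^esub> h j"
      using fh sC[OF j] h by simp
    have fC: "f \<in> carrier ?S" using fM by (simp add: End_ring_simps(1))
    \<comment> \<open>The terms of the relation f - (sum of the \<open>s i\<close>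
      \<open>g i\<close>) = 0. The term at \<open>j\<close> lies in \<open>J j\<close> because of
      the second lift.\<close>
    define y where "y i = (if i = j then f else \<ominus>\<^bsub>?S\<^esub> (s i \<otimes>\<^bsub>?S\<^esub> g i))" for i
    have yJ: "y i \<in> J i" if "i \<in> F" for i
    proof (cases "i = j")
      case True
      then show ?thesis using J_mult sJ F(2) j h by (auto simp: y_def fh')
    next
      \<comment> \<open>Moving the sign onto \<open>g i\<close> writes the term as
        \<open>s i\<close> times an element of S, so it stays in the right ideal.\<close>
      case False
      then have gi: "g i \<in> carrier ?S" using g that by blast
      have "\<ominus>\<^bsub>?S\<^esub> (s i \<otimes>\<^bsub>?S\<^esub> g i) = s i \<otimes>\<^bsub>?S\<^esub> (\<ominus>\<^bsub>?S\<^esub> g i)"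
        using sC[OF that] gi by (simp add: S.r_minus)
      then show ?thesis using False J_mult sJ F(2) that gi by (auto simp: y_def)
    qed
    have sg: "(\<lambda>i. s i \<otimes>\<^bsub>?S\<^esub> g i) \<in> F - {j} \<rightarrow> carrier ?S"
      using g sC by (auto simp: Pi_iff)
    \<comment> \<open>Once \<open>f\<close> is written as the sum of the \<open>s i\<close>
      \<open>g i\<close>, adding it cancels the terms one by one.\<close>
    have neg: "(\<Oplus>\<^bsub>?S\<^esub>i\<in>F - {j}. y i) = \<ominus>\<^bsub>?S\<^esub> f"
    proof -
      have y_eq: "(\<Oplus>\<^bsub>?S\<^esub>i\<in>F - {j}. y i) = (\<Oplus>\<^bsub>?S\<^esub>i\<in>F - {j}. \<ominus>\<^bsub>?S\<^esub> (s i \<otimes>\<^bsub>?S\<^esub> g i))"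
        using sg by (intro S.finsum_cong') (auto simp: y_def)
      have "(\<Oplus>\<^bsub>?S\<^esub>i\<in>F - {j}. y i) \<oplus>\<^bsub>?S\<^esub> f =
          (\<Oplus>\<^bsub>?S\<^esub>i\<in>F - {j}. \<ominus>\<^bsub>?S\<^esub> (s i \<otimes>\<^bsub>?S\<^esub> g i) \<oplus>\<^bsub>?S\<^esub> s i \<otimes>\<^bsub>?S\<^esub> g i)"
        unfolding y_eq by (subst fg, subst S.finsum_addf) (use sg in auto)
      also have "\<dots> = (\<Oplus>\<^bsub>?S\<^esub>i\<in>F - {j}. \<zero>\<^bsub>?S\<^esub>)"
        using sg by (intro S.finsum_cong') (auto simp: S.l_neg Pi_iff)
      finally have "(\<Oplus>\<^bsub>?S\<^esub>i\<in>F - {j}. y i) \<oplus>\<^bsub>?S\<^esub> f = \<zero>\<^bsub>?S\<^esub>" by simp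
      moreover have "(\<Oplus>\<^bsub>?S\<^esub>i\<in>F - {j}. y i) \<in> carrier ?S"
        using yJ J_sub by (intro S.finsum_closed) blast
      ultimately show ?thesis using fC by (metis S.minus_equality)
    qed
    have "(\<Oplus>\<^bsub>?S\<^esub>i\<in>insert j (F - {j}). y i) = y j \<oplus>\<^bsub>?S\<^esub> (\<Oplus>\<^bsub>?S\<^esub>i\<in>F - {j}. y i)"
      using F' yJ J_sub j by (intro S.finsum_insert) blast+
    then have "(\<Oplus>\<^bsub>?S\<^esub>i\<in>F. y i) = \<zero>\<^bsub>?S\<^esub>"
      using j neg fC by (simp add: insert_absorb y_def S.r_neg)
    \<comment> \<open>Independence of the right ideals forces \<open>f\<close> = 0, although
      \<open>f m\<close> is nonzero.\<close>
    then have "y j = \<zero>\<^bsub>?S\<^esub>"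
      using ind[unfolded independent_family_def reg, THEN spec[of _ F], THEN spec[of _ y]] F yJ j
      by simp
    then show False
      using m by (simp add: y_def End_ring_simps)
  qed
qed

text \<open>One nonzero element from each member of an independent sequence of right ideals is
  enough: the images of these elements form an independent sequence of nonzero submodules of
  M.\<close>

lemma finite_uniform_dimension_End_ring:
  assumes proj: "projective_all_copies R M" and retr: "retractable R M"
    and fin: "finite_uniform_dimension R M"
  shows "finite_uniform_dimension (opposite_ring (End_ring R M)) (right_regular_module (End_ring R M))"
  unfolding finite_uniform_dimension_def
proof (rule notI, elim exE conjE)
  let ?S = "End_ring R M"
  fix J :: "nat \<Rightarrow> ('m \<Rightarrow> 'm) set"
  assume J: "\<forall>i. submodule (J i) (opposite_ring ?S) (right_regular_module ?S) \<and>
      J i \<noteq> {\<zero>\<^bsub>right_regular_module ?S\<^esub>}"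
    and ind: "independent_family (right_regular_module ?S) J UNIV"
  have reg: "carrier (right_regular_module ?S) = mod_hom R M M"
    "\<zero>\<^bsub>right_regular_module ?S\<^esub> = \<zero>\<^bsub>?S\<^esub>"
    by (simp_all add: right_regular_module_def End_ring_simps)
  have "\<exists>t. t \<in> J i \<and> t \<noteq> \<zero>\<^bsub>?S\<^esub>" for i
  proof -
    have "J i \<noteq> {\<zero>\<^bsub>?S\<^esub>}" using J unfolding reg by blast
    moreover have "submodule (J i) (opposite_ring ?S) (right_regular_module ?S)" using J by blast
    from submoduleD(2)[OF this] have "\<zero>\<^bsub>?S\<^esub> \<in> J i" unfolding reg .
    ultimately show ?thesis by blast
  qed
  then obtain s where s: "\<And>i. s i \<in> J i" "\<And>i. s i \<noteq> \<zero>\<^bsub>?S\<^esub>" by metis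
  have sM: "s i \<in> mod_hom R M M" for i
  proof -
    have "submodule (J i) (opposite_ring ?S) (right_regular_module ?S)" using J by blast
    from submoduleD(1)[OF this] show ?thesis using s(1) unfolding reg by blast
  qed
  \<comment> \<open>Homomorphisms are \<open>undefined\<close> off the carrier, so one with zero
    image equals the zero of S as a function.\<close>
  have "s i ` carrier M \<noteq> {\<zero>\<^bsub>M\<^esub>}" for i
  proof
    assume "s i ` carrier M = {\<zero>\<^bsub>M\<^esub>}"
    then have "s i = \<zero>\<^bsub>?S\<^esub>"
      using mod_homD(1)[OF sM[of i]]
      by (auto simp: End_ring_simps fun_eq_iff PiE_iff extensional_def)
    with s(2) show False by blast
  qed
  moreover have "submodule (s i ` carrier M) R M" for i
    by (intro mod_hom_image_submodule left_module_axioms sM)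
  moreover have "independent_family M (\<lambda>i. s i ` carrier M) UNIV"
    by (rule independent_images[OF proj retr _ ind]) (simp_all add: J s(1))
  ultimately have "\<exists>N :: nat \<Rightarrow> 'm set. (\<forall>i. submodule (N i) R M \<and> N i \<noteq> {\<zero>\<^bsub>M\<^esub>}) \<and>
      independent_family M N UNIV"
    by (intro exI[of _ "\<lambda>i. s i ` carrier M"]) simp
  with fin show False
    unfolding finite_uniform_dimension_def by (rule notE)
qed

end

theorem lemma5p3:
  fixes R :: "('r, 'x) ring_scheme" and M :: "('r, 'm, 'y) module_scheme"
  assumes "ring R" and "left_module R M"
    and "projective_all_copies R M"
    and "retractable R M"
    and "Goldie_module R M"
  shows "right_Goldie_ring (End_ring R M)"
proof -
  interpret left_module R M by fact
  show ?thesis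
    using assms(3-5) ring_End_ring acc_right_annihilators_End_ring finite_uniform_dimension_End_ring
    unfolding right_Goldie_ring_def Goldie_module_def by blast
qed

end
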